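(* Let $K$ be a two-bridge link (or knot), and let $\alpha\in\mathbf{C}$ be a root of its Alexander polynomial $\Delta_K$. Then $$-\frac32<\operatorname{Re}\alpha<3+2\sqrt2.$$ If moreover $\alpha$ is real, then $3-2\sqrt2<\alpha<3+2\sqrt2$.
   Context: The Alexander polynomial of an oriented link $K$ is $\Delta_K(t)=\nabla_K(t^{1/2}-t^{-1/2})$ (up to sign), where $\nabla_K(z)\in\mathbf{Z}[z]$ is the Conway polynomial, defined by $\nabla_{\text{unknot}}=1$ and $\nabla_{L_+}-\nabla_{L_-}=z\nabla_{L_0}$. A root $\alpha$ is a nonzero complex number such that, for a choice of square root $\alpha^{1/2}$, $\nabla_K(\alpha^{1/2}-\alpha^{-1/2})=0$. Two-bridge links: for nonzero integers $b_1,\dots,b_m$ ($m\ge 0$), $C(2b_1,-2b_2,\dots,(-1)^{m-1}2b_m)$ denotes the two-bridge link in Conway normal form with these numbers of signed crossings in its successive twist regions (its Schubert fraction is the continued fraction $[2b_1,-2b_2,\dots,(-1)^{m-1}2b_m]$, where $[a_1,\dots,a_n]=a_1+1/(a_2+1/(\cdots+1/a_n))$), oriented so that the two strands of each twist region are antiparallel. Every oriented two-bridge link is of this form. It is known (Siebenmann; Cromwell) that its Conway polynomial is the Euler continuant polynomial $D_m(b_1,\dots,b_m)(z)$, defined by $D_{-1}=0$, $D_0=1$, $D_k=b_k z D_{k-1}+D_{k-2}$, equivalently the determinant of the $m\times m$ tridiagonal matrix with diagonal entries $b_1z,\dots,b_mz$, superdiagonal entries $-1$ and subdiagonal entries $1$.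 *)

theory Defs
  imports Complex_Main "HOL-Computational_Algebra.Polynomial"
begin

section \<open>Oriented link diagrams\<close>

text \<open>
  A diagram in Morse position is cut into horizontal slices, each containing one cup, one cap or
  one crossing, and is recorded as the list of its slices from bottom to top. In a slice (i, g)
  there are i vertical strands to the left of the piece g. Each level is described by the list of
  orientations of the strands met from left to right, where True means upwards.

  Cup b is a local minimum whose left leg has orientation b. In Cross s the strand running from
  bottom left to top right is the over-strand iff s holds; the two strands may be oriented in
  either way.
\<close>

datatype piece = Cup bool | Cap | Cross bool

type_synonym slice = "nat \<times> piece"

type_synonym diagram = "slice list"

fun step :: "slice \<Rightarrow> bool list \<Rightarrow> bool list option" where
  "step (i, Cup b) xs =
     (if i \<le> length xs then Some (take i xs @ [b, \<not> b] @ drop i xs) else None)"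
| "step (i, Cap) xs =
     (if Suc i < length xs \<and> xs ! i \<noteq> xs ! Suc i
      then Some (take i xs @ drop (i + 2) xs) else None)"
| "step (i, Cross s) xs =
     (if Suc i < length xs
      then Some (take i xs @ [xs ! Suc i, xs ! i] @ drop (i + 2) xs) else None)"

fun run :: "diagram \<Rightarrow> bool list \<Rightarrow> bool list option" where
  "run [] xs = Some xs"
| "run (s # w) xs = Option.bind (step s xs) (run w)"

definition link_diagram :: "diagram \<Rightarrow> bool" where
  "link_diagram w \<longleftrightarrow> run w [] = Some []"


section \<open>Isotopy\<close>

fun width_in :: "piece \<Rightarrow> nat" where
  "width_in (Cup b) = 0"
| "width_in Cap = 2"
| "width_in (Cross s) = 2"

fun width_out :: "piece \<Rightarrow> nat" where
  "width_out (Cup b) = 2"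
| "width_out Cap = 0"
| "width_out (Cross s) = 2"

text \<open>
  Local moves between diagrams in Morse position: planar isotopies (rules far, zigzag and slide)
  and the Reidemeister moves. These are the standard relations presenting the category of
  tangles up to isotopy; the remaining variants of the third Reidemeister move follow from the
  one given and the second.
\<close>

inductive local_move :: "diagram \<Rightarrow> diagram \<Rightarrow> bool" where
  far: "i \<le> k \<Longrightarrow>
    local_move [(i, g), (k + width_out g, h)] [(k + width_in g, h), (i, g)]"
| zigzag_right: "local_move [(i, Cup b), (Suc i, Cap)] []"
| zigzag_left: "local_move [(Suc i, Cup b), (i, Cap)] []"
| slide_cup: "local_move [(i, Cup b), (Suc i, Cross s)] [(Suc i, Cup b), (i, Cross (\<not> s))]"
| slide_cap: "local_move [(Suc i, Cross s), (i, Cap)] [(i, Cross (\<not> s)), (Suc i, Cap)]"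
| R1_cup: "local_move [(i, Cup b), (i, Cross s)] [(i, Cup (\<not> b))]"
| R1_cap: "local_move [(i, Cross s), (i, Cap)] [(i, Cap)]"
| R2: "local_move [(i, Cross s), (i, Cross (\<not> s))] []"
| R3: "local_move [(i, Cross s), (Suc i, Cross s), (i, Cross s)]
                  [(Suc i, Cross s), (i, Cross s), (Suc i, Cross s)]"

inductive move :: "diagram \<Rightarrow> diagram \<Rightarrow> bool" where
  "local_move l r \<Longrightarrow> link_diagram (u @ l @ v) \<Longrightarrow> link_diagram (u @ r @ v) \<Longrightarrow>
    move (u @ l @ v) (u @ r @ v)"

definition isotopic :: "diagram \<Rightarrow> diagram \<Rightarrow> bool" where
  "isotopic = equivclp move"


section \<open>The Conway polynomial and the roots of the Alexander polynomial\<close>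

definition unknot :: diagram where
  "unknot = [(0, Cup True), (0, Cap)]"

text \<open>
  Skein triples (L+, L-, L0). For parallel strands Cross True is the positive crossing and the
  oriented smoothing consists of two vertical strands; for antiparallel strands Cross False is
  the positive crossing and the oriented smoothing is a cap below a cup.
\<close>

inductive skein_triple :: "diagram \<Rightarrow> diagram \<Rightarrow> diagram \<Rightarrow> bool" where
  parallel:
    "run u [] = Some xs \<Longrightarrow> Suc i < length xs \<Longrightarrow> xs ! i = xs ! Suc i \<Longrightarrow>
     link_diagram (u @ (i, Cross True) # v) \<Longrightarrow>
     skein_triple (u @ (i, Cross True) # v) (u @ (i, Cross False) # v) (u @ v)"
| antiparallel:
    "run u [] = Some xs \<Longrightarrow> Suc i < length xs \<Longrightarrow> xs ! i \<noteq> xs ! Suc i \<Longrightarrow>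
     link_diagram (u @ (i, Cross True) # v) \<Longrightarrow>
     skein_triple (u @ (i, Cross False) # v) (u @ (i, Cross True) # v)
       (u @ [(i, Cap), (i, Cup (xs ! Suc i))] @ v)"

text \<open>
  The Conway polynomial is the link invariant determined, on nonempty links, by its
  normalisation and the skein relation. The variable z is [:0, 1:].
\<close>

definition conway_polynomial :: "(diagram \<Rightarrow> int poly) \<Rightarrow> bool" where
  "conway_polynomial nabla \<longleftrightarrow>
     (\<forall>D E. isotopic D E \<longrightarrow> nabla D = nabla E) \<and>
     nabla unknot = 1 \<and>
     (\<forall>Dp Dm D0. skein_triple Dp Dm D0 \<longrightarrow> nabla Dp - nabla Dm = [:0, 1:] * nabla D0)"

text \<open>
  A root of the Alexander polynomial of a link with Conway polynomial p; here w is a choice of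
  the square root of the root.
\<close>

definition alexander_root :: "int poly \<Rightarrow> complex \<Rightarrow> bool" where
  "alexander_root p \<alpha> \<longleftrightarrow>
     \<alpha> \<noteq> 0 \<and> (\<exists>w. w\<^sup>2 = \<alpha> \<and> poly (map_poly of_int p) (w - inverse w) = 0)"


section \<open>Two-bridge links\<close>

text \<open>
  The Conway normal form C(a1, ..., an) as a 4-plat. Twist regions alternate between the two
  middle strands and the two left strands, and the sign convention for crossings alternates
  with them, so that the diagram is alternating if all entries are positive. A single region
  with entry a > 0 and antiparallel strands has positive crossings.

  All strands are given the orientations up, down, up, down. This is consistent if all entries
  are even, since then every twist region is a pure braid, and it makes the two strands of each
  twist region antiparallel.
\<close>

definition twist :: "nat \<Rightarrow> int \<Rightarrow> diagram" where
  "twist i a = replicate (nat \<bar>a\<bar>) (i, Cross (a < 0))"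

fun twist_regions :: "bool \<Rightarrow> int list \<Rightarrow> diagram" where
  "twist_regions middle [] = []"
| "twist_regions middle (a # as) =
     (if middle then twist 1 a else twist 0 (- a)) @ twist_regions (\<not> middle) as"

definition conway_form :: "int list \<Rightarrow> diagram" where
  "conway_form as =
     [(0, Cup True), (2, Cup True)] @ twist_regions True as @
     (if odd (length as) then [(0, Cap), (0, Cap)] else [(1, Cap), (0, Cap)])"

text \<open>
  The oriented link C(2 b1, -2 b2, 2 b3, ...), and the oriented links of this form. Every
  oriented two-bridge link has such a normal form with nonzero entries; the empty list gives
  the unknot, and the two-component unlink is not included.
\<close>

definition even_conway_form :: "int list \<Rightarrow> diagram" where
  "even_conway_form bs = conway_form (map (\<lambda>k. (- 1) ^ k * 2 * bs ! k) [0..<length bs])"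

definition two_bridge :: "diagram \<Rightarrow> bool" where
  "two_bridge K \<longleftrightarrow> (\<exists>bs. 0 \<notin> set bs \<and> isotopic K (even_conway_form bs))"

lemma run_append: "run (u @ v) xs = Option.bind (run u xs) (run v)"
  by (induction u arbitrary: xs) (auto simp: Option.bind_assoc intro!: arg_cong2[where f = Option.bind])

lemma run_even_twist:
  assumes "even a" "i = 0 \<or> i = 1"
  shows "run (twist i a) [True, False, True, False] = Some [True, False, True, False]"
proof -
  obtain n where n: "nat \<bar>a\<bar> = n + n"
    using assms(1) by (metis abs_ge_zero dvd_abs_iff evenE even_nat_iff mult_2)
  have "run (replicate (n + n) (i, Cross s)) [True, False, True, False]
          = Some [True, False, True, False]" for s
    using assms(2) by (induction n) auto
  then show ?thesis
    by (simp add: twist_def n)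
qed

lemma run_even_twist_regions:
  assumes "\<forall>a \<in> set as. even a"
  shows "run (twist_regions middle as) [True, False, True, False]
           = Some [True, False, True, False]"
  using assms by (induction middle as rule: twist_regions.induct)
    (auto simp: run_append run_even_twist)

lemma link_diagram_even_conway_form: "link_diagram (even_conway_form bs)"
  by (auto simp: link_diagram_def even_conway_form_def conway_form_def run_append
      run_even_twist_regions)

end

theory Submission
  imports Defs
begin

text \<open>
  Write $\alpha = w^2$ and $z = w - w^{-1}$. The theorem comes from the single inequality
  $|z| < 2$ for the zeros of the Conway polynomial.

  The Conway polynomial of an even Conway form obeys the continuant recursion
  $D_m = b_m z D_{m-1} + D_{m-2}$. To see this, apply the skein relation to the last twist
  region. Changing one of its crossings cancels two of them by the second Reidemeister move, and
  smoothing one of them deletes the whole region, because the remaining crossings are undone by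
  the cap next to them; so $b_m$ drops by one at the price of $z D_{m-1}$ (lemma
  \<open>nabla_twist\<close>). Once the last region is empty, the closing caps undo the region before
  it as well, and $D_{m-2}$ remains. The recursion starts with the unknot, $D_0 = 1$, and with
  the two-component unlink, whose polynomial $0$ plays the part of $D_{-1}$.

  If $|z| \ge 2$, then $|b_m z| \ge 2$ because $b_m$ is a nonzero integer, and the recursion
  forces $|D_m| \ge 2 |D_{m-1}| - |D_{m-2}|$, so that $|D_m|$ increases strictly with $m$ and
  never vanishes (lemma \<open>nabla_nonzero_outside_disc\<close>).

  Finally $\alpha - 1 = w z$, so $|z| < 2$ says $|\alpha - 1|^2 < 4 |\alpha|$, that is,
  $r^2 - 2 \, \mathrm{Re}\, \alpha + 1 < 4 r$ with $r = |\alpha|$. Minimising over $r$ (at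
  $r = 2$) gives the lower bound $-3/2$, and $\mathrm{Re}\, \alpha \le r$ gives
  $(r - 1)^2 < 4 r$, which confines $r$ between $3 - 2 \sqrt 2$ and $3 + 2 \sqrt 2$. A negative
  real $\alpha$ would give $(r + 1)^2 < 4 r$, which is impossible.
\<close>

section \<open>Moves that simplify a diagram\<close>

text \<open>
  A local move read in the direction in which it preserves composability with every context:
  the right-hand side then extends to a link diagram whenever the left-hand side does. In the
  other direction this fails, since the empty word, for instance, runs on too few strands.
\<close>
definition reduces :: "diagram \<Rightarrow> diagram \<Rightarrow> bool" where
  "reduces l r \<longleftrightarrow> local_move l r \<and> (\<forall>xs ys. run l xs = Some ys \<longrightarrow> run r xs = Some ys)"

lemma link_diagram_reduces:
  assumes "reduces l r" "link_diagram (u @ l @ v)"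
  shows "link_diagram (u @ r @ v)"
  using assms by (auto simp: reduces_def link_diagram_def run_append bind_eq_Some_conv)

lemma conway_polynomial_reduces:
  assumes "conway_polynomial nabla" "reduces l r" "link_diagram (u @ l @ v)"
  shows "nabla (u @ l @ v) = nabla (u @ r @ v)"
proof -
  have "move (u @ l @ v) (u @ r @ v)"
    using assms(2,3) link_diagram_reduces[OF assms(2,3)] by (auto simp: reduces_def intro: move.intros)
  then have "isotopic (u @ l @ v) (u @ r @ v)"
    by (auto simp: isotopic_def)
  then show ?thesis
    using assms(1) by (auto simp: conway_polynomial_def)
qed

lemma take_swap_drop:
  assumes "Suc i < length xs"
  shows "take i xs @ xs ! i # xs ! Suc i # drop (Suc (Suc i)) xs = xs"
  using assms by (metis Cons_nth_drop_Suc Suc_lessD append_take_drop_id)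

lemma reduces_R1_cap: "reduces [(i, Cross s), (i, Cap)] [(i, Cap)]"
  by (auto simp: reduces_def nth_append split: if_splits intro: local_move.R1_cap)

lemma reduces_R2: "reduces [(i, Cross s), (i, Cross (\<not> s))] []"
  by (auto simp: reduces_def nth_append take_swap_drop split: if_splits intro: local_move.R2)

text \<open>
  The cap of a zigzag composes only if the strand running through it has the orientation of the
  outer leg of the cup, so straightening the zigzag leaves the orientations unchanged.
\<close>
lemma reduces_zigzag_right: "reduces [(i, Cup b), (Suc i, Cap)] []"
proof -
  have "ys = xs" if run: "run [(i, Cup b), (Suc i, Cap)] xs = Some ys" for xs ys
  proof -
    have i: "i < length xs"
      using run by (auto split: if_splits)
    then obtain ps x qs where xs: "xs = ps @ x # qs" "length ps = i"
      using id_take_nth_drop[OF i] by (metis length_take less_imp_le min.absorb2)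
    then show ?thesis
      using run by (auto simp: nth_append split: if_splits)
  qed
  then show ?thesis
    unfolding reduces_def by (intro conjI allI impI local_move.zigzag_right) (metis run.simps(1))
qed

lemma reduces_zigzag_left: "reduces [(Suc i, Cup b), (i, Cap)] []"
proof -
  have "ys = xs" if run: "run [(Suc i, Cup b), (i, Cap)] xs = Some ys" for xs ys
  proof -
    have i: "i < length xs"
      using run by (auto split: if_splits)
    then obtain ps x qs where xs: "xs = ps @ x # qs" "length ps = i"
      using id_take_nth_drop[OF i] by (metis length_take less_imp_le min.absorb2)
    then show ?thesis
      using run by (auto simp: nth_append split: if_splits)
  qed
  then show ?thesis
    unfolding reduces_def by (intro conjI allI impI local_move.zigzag_left) (metis run.simps(1))
qed

text \<open>
  A twist region that ends in a cap on the same two strands is a stack of kinks, removed from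
  the cap downwards by the first Reidemeister move.
\<close>
lemma nabla_untwist_cap:
  assumes "conway_polynomial nabla" "link_diagram (u @ replicate n (i, Cross s) @ (i, Cap) # v)"
  shows "nabla (u @ replicate n (i, Cross s) @ (i, Cap) # v) = nabla (u @ (i, Cap) # v)"
  using assms(2)
proof (induction n)
  case (Suc n)
  let ?u = "u @ replicate n (i, Cross s)"
  have eq: "u @ replicate (Suc n) (i, Cross s) @ (i, Cap) # v = ?u @ [(i, Cross s), (i, Cap)] @ v"
    by (simp flip: replicate_append_same)
  note link = Suc.prems[unfolded eq]
  have "nabla (?u @ [(i, Cross s), (i, Cap)] @ v) = nabla (?u @ [(i, Cap)] @ v)"
    by (rule conway_polynomial_reduces[OF assms(1) reduces_R1_cap link])
  moreover have "link_diagram (?u @ [(i, Cap)] @ v)"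
    by (rule link_diagram_reduces[OF reduces_R1_cap link])
  ultimately show ?case
    unfolding eq using Suc.IH by simp
qed simp

section \<open>The Conway polynomial of a two-bridge link\<close>

text \<open>
  Changing the crossing of a kink in an unknot gives an unknot again, while smoothing that
  crossing splits the unknot in two; so the skein relation reads $0 = z \nabla$ for the unlink.
\<close>
lemma nabla_two_component_unlink:
  assumes "conway_polynomial nabla"
  shows "nabla [(0, Cup True), (2, Cup True), (0, Cap), (0, Cap)] = 0"
proof -
  \<comment> \<open>The first crossing is there only to turn the cup around, so that smoothing the second one
    produces a cup with the orientation required.\<close>
  let ?u = "[(0, Cup True), (0, Cross True)]" and ?v = "[(0, Cap)]"
  have unknot: "nabla (?u @ (0, Cross s) # ?v) = nabla [(0, Cup True), (0, Cap)]" for s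
  proof -
    have "nabla (?u @ [(0, Cross s), (0, Cap)] @ []) = nabla (?u @ [(0, Cap)] @ [])"
      by (rule conway_polynomial_reduces[OF assms reduces_R1_cap]) (simp add: link_diagram_def)
    moreover have "nabla ([(0, Cup True)] @ [(0, Cross True), (0, Cap)] @ []) =
        nabla ([(0, Cup True)] @ [(0, Cap)] @ [])"
      by (rule conway_polynomial_reduces[OF assms reduces_R1_cap]) (simp add: link_diagram_def)
    ultimately show ?thesis by simp
  qed
  have "skein_triple (?u @ (0, Cross False) # ?v) (?u @ (0, Cross True) # ?v)
      (?u @ [(0, Cap), (0, Cup ([False, True] ! Suc 0))] @ ?v)"
    by (rule skein_triple.antiparallel) (auto simp: link_diagram_def)
  then have "nabla (?u @ (0, Cross False) # ?v) - nabla (?u @ (0, Cross True) # ?v)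
      = [:0, 1:] * nabla (?u @ [(0, Cap), (0, Cup ([False, True] ! Suc 0))] @ ?v)"
    using assms unfolding conway_polynomial_def by blast
  then have "nabla (?u @ [(0, Cap), (0, Cup True)] @ ?v) = 0"
    by (simp only: unknot) simp
  moreover have "nabla ([(0, Cup True)] @ [(0, Cross True), (0, Cap)] @ [(0, Cup True), (0, Cap)]) =
      nabla ([(0, Cup True)] @ [(0, Cap)] @ [(0, Cup True), (0, Cap)])"
    by (rule conway_polynomial_reduces[OF assms reduces_R1_cap]) (simp add: link_diagram_def)
  moreover have "nabla ([(0, Cup True)] @ [(0, Cap), (0, Cup True)] @ [(0, Cap)])
      = nabla ([(0, Cup True)] @ [(2, Cup True), (0, Cap)] @ [(0, Cap)])"
  proof -
    have "local_move [(0, Cap), (0, Cup True)] [(2, Cup True), (0, Cap)]"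
      using local_move.far[of 0 0 Cap "Cup True"] by (simp add: numeral_2_eq_2)
    then have "move ([(0, Cup True)] @ [(0, Cap), (0, Cup True)] @ [(0, Cap)])
        ([(0, Cup True)] @ [(2, Cup True), (0, Cap)] @ [(0, Cap)])"
      by (rule move.intros) (simp_all add: link_diagram_def numeral_2_eq_2)
    then have "isotopic ([(0, Cup True)] @ [(0, Cap), (0, Cup True)] @ [(0, Cap)])
        ([(0, Cup True)] @ [(2, Cup True), (0, Cap)] @ [(0, Cap)])"
      by (auto simp: isotopic_def)
    then show ?thesis
      using assms unfolding conway_polynomial_def by blast
  qed
  ultimately show ?thesis by simp
qed

abbreviation up_down :: "bool list" where
  "up_down \<equiv> [True, False, True, False]"

text \<open>
  The position of the twist region with index \<open>n\<close>, counted from 0. The same number is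
  the position of the first cap in the closure of a plat with \<open>n\<close> regions: that cap sits
  where a further region would be, and hence, for \<open>n > 1\<close>, also where the last region but
  one is.
\<close>
definition strand :: "nat \<Rightarrow> nat" where
  "strand n = (if even n then 1 else 0)"

definition closure :: "nat \<Rightarrow> diagram" where
  "closure n = [(strand n, Cap), (0, Cap)]"

lemma run_closure: "run (closure n) up_down = Some []"
  by (simp add: closure_def strand_def)

lemma run_replicate_even:
  "run (replicate (2 * n) (strand m, Cross s)) up_down = Some up_down"
  by (induction n) (auto simp: strand_def)

text \<open>
  The skein relation at the top crossing of a region, which has an odd number of crossings below
  it. The opposite crossing cancels against the one below. In the smoothing, the new cup forms a
  zigzag with the first closing cap, and the new cap undoes the region and becomes the first cap
  of the shorter closure.
\<close>
lemma nabla_crossing_pair: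
  assumes nabla: "conway_polynomial nabla" and P: "run P [] = Some up_down"
  shows "nabla (P @ replicate (2 * Suc n) (strand m, Cross s) @ closure (Suc m))
    = nabla (P @ replicate (2 * n) (strand m, Cross s) @ closure (Suc m))
      + [:0, if s then - 1 else 1:] * nabla (P @ closure m)"
proof -
  let ?i = "strand m"
  let ?Q = "P @ replicate (2 * n) (?i, Cross s)"
  let ?u = "?Q @ [(?i, Cross s)]"
  \<comment> \<open>After an odd number of crossings the two strands of the region are exchanged.\<close>
  let ?xs = "if ?i = 0 then [False, True, True, False] else [True, True, False, False]"
  have Q: "run ?Q [] = Some up_down"
    by (simp add: run_append P run_replicate_even)
  have u: "run ?u [] = Some ?xs"
    unfolding run_append[of ?Q] Q by (simp add: strand_def)
  have link: "link_diagram (?u @ (?i, Cross t) # closure (Suc m))" for t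
    unfolding link_diagram_def run_append[of ?u] u by (simp add: strand_def closure_def)
  let ?b = "?xs ! Suc ?i"
  have "skein_triple (?u @ (?i, Cross False) # closure (Suc m)) (?u @ (?i, Cross True) # closure (Suc m))
      (?u @ [(?i, Cap), (?i, Cup ?b)] @ closure (Suc m))"
    by (rule skein_triple.antiparallel[OF u _ _ link]) (auto simp: strand_def)
  then have skein: "nabla (?u @ (?i, Cross False) # closure (Suc m)) -
      nabla (?u @ (?i, Cross True) # closure (Suc m))
      = [:0, 1:] * nabla (?u @ [(?i, Cap), (?i, Cup ?b)] @ closure (Suc m))"
    using nabla unfolding conway_polynomial_def by blast
  have cancel: "nabla (?u @ (?i, Cross (\<not> s)) # closure (Suc m)) = nabla (?Q @ closure (Suc m))"
    using conway_polynomial_reduces[OF nabla reduces_R2, of ?Q ?i s "closure (Suc m)"] link[of "\<not> s"]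
    by simp
  have smooth: "nabla (?u @ [(?i, Cap), (?i, Cup ?b)] @ closure (Suc m)) = nabla (P @ closure m)"
  proof -
    let ?z = "[(?i, Cup ?b), (strand (Suc m), Cap)]"
    have red: "reduces ?z []"
      using reduces_zigzag_right[of 0] reduces_zigzag_left[of 0] by (simp add: strand_def)
    have eq: "?u @ [(?i, Cap), (?i, Cup ?b)] @ closure (Suc m) = (?u @ [(?i, Cap)]) @ ?z @ [(0, Cap)]"
      by (simp add: closure_def)
    have l: "link_diagram ((?u @ [(?i, Cap)]) @ ?z @ [(0, Cap)])"
      unfolding link_diagram_def append_assoc[of ?u] run_append[of ?u] u by (simp add: strand_def)
    have "nabla ((?u @ [(?i, Cap)]) @ ?z @ [(0, Cap)]) = nabla ((?u @ [(?i, Cap)]) @ [] @ [(0, Cap)])"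
      by (rule conway_polynomial_reduces[OF nabla red l])
    moreover have "link_diagram ((?u @ [(?i, Cap)]) @ [] @ [(0, Cap)])"
      by (rule link_diagram_reduces[OF red l])
    moreover have "(?u @ [(?i, Cap)]) @ [] @ [(0, Cap)]
        = P @ replicate (Suc (2 * n)) (?i, Cross s) @ (?i, Cap) # [(0, Cap)]"
      by (simp flip: replicate_append_same)
    ultimately show ?thesis
      unfolding eq using nabla_untwist_cap[OF nabla, of P "Suc (2 * n)" ?i s "[(0, Cap)]"]
      by (simp only: closure_def)
  qed
  have full: "P @ replicate (2 * Suc n) (?i, Cross s) @ closure (Suc m) = ?u @ (?i, Cross s) # closure (Suc m)"
    using replicate_append_same[of "2*n" "(?i, Cross s)"]
    by (metis (no_types, lifting) add_2_eq_Suc append.assoc append_Cons append_Nil mult_Suc_right replicate_Suc)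
  have sign: "[:0, if s then - 1 else 1:] = (if s then - [:0, 1:] else [:0, 1 :: int:])"
    by simp
  have arith: "q = p + - z * r" "p = q + z * r" if "p - q = z * r" for p q z r :: "int poly"
    using that by (simp_all add: algebra_simps)
  note skein = arith[OF skein[unfolded smooth]]
  show ?thesis
  proof (cases s)
    case True
    then show ?thesis
      using skein(1) cancel unfolding full sign
      by (simp only: if_True not_True_eq_False append_assoc)
  next
    case False
    then show ?thesis
      using skein(2) cancel unfolding full sign
      by (simp only: if_False not_False_eq_True append_assoc)
  qed
qed

lemma nabla_twist:
  assumes nabla: "conway_polynomial nabla" and P: "run P [] = Some up_down"
  shows "nabla (P @ twist (strand m) (2 * b) @ closure (Suc m))
    = [:0, b:] * nabla (P @ closure m) + nabla (P @ closure (Suc m))"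
proof -
  have "nabla (P @ replicate (2 * n) (strand m, Cross s) @ closure (Suc m))
      = [:0, if s then - int n else int n:] * nabla (P @ closure m) + nabla (P @ closure (Suc m))" for n s
  proof (induction n)
    case (Suc n)
    have "[:0, if s then - int (Suc n) else int (Suc n):] =
        [:0, if s then - int n else int n:] + [:0, if s then - 1 else 1:]"
      by simp
    then show ?case
      unfolding nabla_crossing_pair[OF assms] Suc.IH by (simp only: algebra_simps)
  qed simp
  from this[of "nat \<bar>b\<bar>" "b < 0"] show ?thesis
    by (auto simp: twist_def abs_mult nat_mult_distrib)
qed

text \<open>
  The even Conway form before closing. The alternating signs of its entries cancel against the
  alternating sign convention for the twist regions, so that each entry \<open>b\<close> contributes
  \<open>2 * b\<close> crossings with the sign of \<open>b\<close>, in either position.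
\<close>
definition plat :: "int list \<Rightarrow> diagram" where
  "plat bs = [(0, Cup True), (2, Cup True)] @
     concat (map (\<lambda>k. twist (strand k) (2 * bs ! k)) [0..<length bs])"

lemma plat_snoc: "plat (bs @ [b]) = plat bs @ twist (strand (length bs)) (2 * b)"
proof -
  have "map (\<lambda>k. twist (strand k) (2 * (bs @ [b]) ! k)) [0..<length bs] =
      map (\<lambda>k. twist (strand k) (2 * bs ! k)) [0..<length bs]"
    by (rule map_cong) (simp_all add: nth_append)
  then show ?thesis
    by (simp add: plat_def del: map_eq_conv)
qed

lemma run_plat: "run (plat bs) [] = Some up_down"
proof (induction bs rule: rev_induct)
  case Nil
  then show ?case by (simp add: plat_def numeral_2_eq_2)
next
  case (snoc b bs)
  then show ?case
    by (simp add: plat_snoc run_append run_even_twist strand_def)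
qed

lemma twist_regions_snoc:
  "twist_regions mid (as @ [a]) = twist_regions mid as @
     (if mid = even (length as) then twist 1 a else twist 0 (- a))"
  by (induction mid as rule: twist_regions.induct) auto

lemma even_conway_form_eq: "even_conway_form bs = plat bs @ closure (length bs)"
proof -
  have "twist_regions True (map (\<lambda>k. (- 1) ^ k * 2 * bs ! k) [0..<n]) =
      concat (map (\<lambda>k. twist (strand k) (2 * bs ! k)) [0..<n])" for n
    by (induction n) (auto simp: twist_regions_snoc strand_def)
  then show ?thesis
    by (simp add: even_conway_form_def conway_form_def plat_def closure_def strand_def)
qed

text \<open>
  With the last region emptied, the closure of the plat starts with a cap on the strands of the
  region before, which is therefore undone too; this leaves the polynomial of the form with
  two entries fewer.
\<close>
lemma nabla_even_conway_form_snoc2: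
  assumes nabla: "conway_polynomial nabla"
  shows "nabla (even_conway_form (bs @ [a, b])) =
    [:0, b:] * nabla (even_conway_form (bs @ [a])) + nabla (even_conway_form bs)"
proof -
  let ?n = "length bs"
  have "nabla (plat (bs @ [a]) @ closure (Suc (Suc ?n))) = nabla (plat bs @ closure ?n)"
  proof -
    have "link_diagram (plat (bs @ [a]) @ closure (Suc (Suc ?n)))"
      by (simp add: link_diagram_def run_append run_plat run_closure)
    then show ?thesis
      using nabla_untwist_cap[OF nabla, of "plat bs" "nat \<bar>2 * a\<bar>" "strand ?n" "2 * a < 0" "[(0, Cap)]"]
      by (simp add: plat_snoc closure_def twist_def strand_def)
  qed
  then show ?thesis
    using nabla_twist[OF nabla run_plat, of "bs @ [a]" "Suc ?n" b] plat_snoc[of "bs @ [a]" b]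
    by (simp add: even_conway_form_eq)
qed

lemma nabla_even_conway_form_single:
  assumes "conway_polynomial nabla"
  shows "nabla (even_conway_form [b]) = [:0, b:] * nabla (even_conway_form [])"
  using nabla_twist[OF assms run_plat, of "[]" 0 b] nabla_two_component_unlink[OF assms]
    plat_snoc[of "[]" b]
  by (simp add: even_conway_form_eq) (simp add: plat_def closure_def strand_def)

lemma nabla_even_conway_form_Nil:
  assumes nabla: "conway_polynomial nabla"
  shows "nabla (even_conway_form []) = 1"
proof -
  have "nabla ([(0, Cup True)] @ [(2, Cup True), (Suc 0, Cap)] @ [(0, Cap)]) =
    nabla ([(0, Cup True)] @ [] @ [(0, Cap)])"
    unfolding numeral_2_eq_2
    by (rule conway_polynomial_reduces[OF nabla reduces_zigzag_left]) (simp add: link_diagram_def)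
  then show ?thesis
    using nabla by (simp add: even_conway_form_def conway_form_def conway_polynomial_def unknot_def)
qed

section \<open>Location of the roots\<close>

lemma continuant_step_norm:
  fixes p q z :: complex
  assumes "2 \<le> cmod z" "b \<noteq> 0" "cmod q < cmod p"
  shows "cmod p < cmod (of_int b * z * p + q)"
proof -
  have "1 \<le> cmod (of_int b :: complex)"
    using assms(2) by simp
  then have "1 * 2 \<le> cmod (of_int b) * cmod z"
    by (intro mult_mono) (use assms(1) in auto)
  then have "2 * cmod p \<le> cmod (of_int b * z * p)"
    by (simp add: norm_mult mult_right_mono)
  also have "\<dots> \<le> cmod (of_int b * z * p + q) + cmod q"
    using norm_triangle_ineq4[of "of_int b * z * p + q" q] by simp
  finally show ?thesis using assms(3) by simp
qed

lemma poly_of_int_recurrence: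
  fixes p q :: "int poly" and z :: complex
  shows "poly (map_poly of_int ([:0, b:] * p + q)) z =
    of_int b * z * poly (map_poly of_int p) z + poly (map_poly of_int q) z"
proof -
  have 1: "map_poly of_int (p + q) = (map_poly of_int p + map_poly of_int q :: complex poly)" for p q
    by (rule poly_eqI) (simp add: coeff_map_poly)
  have 2: "map_poly of_int (smult b p) = (smult (of_int b) (map_poly of_int p) :: complex poly)" for p
    by (rule poly_eqI) (simp add: coeff_map_poly)
  have 3: "[:0, b:] * p = pCons 0 (smult b p)"
    by simp
  show ?thesis
    unfolding 1 3 by (simp add: map_poly_pCons 2 mult_ac)
qed

text \<open>
  The induction is on the strict growth of the norms rather than on nonvanishing, because the
  recursion bounds a continuant from below only if its two predecessors are compared.
\<close>
lemma nabla_nonzero_outside_disc: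
  assumes nabla: "conway_polynomial nabla" and z: "2 \<le> cmod z" and "0 \<notin> set bs"
  shows "poly (map_poly of_int (nabla (even_conway_form bs))) z \<noteq> 0"
proof -
  let ?d = "\<lambda>bs. poly (map_poly of_int (nabla (even_conway_form bs))) z"
  have Nil: "?d [] = 1"
    by (simp add: nabla_even_conway_form_Nil[OF nabla])
  have "cmod (?d bs) < cmod (?d (bs @ [b]))" if "0 \<notin> set (bs @ [b])" for bs b
    using that
  proof (induction bs arbitrary: b rule: rev_induct)
    case Nil
    then show ?case
      using continuant_step_norm[OF z, of b 0 1] poly_of_int_recurrence[of b 1 0 z]
      by (simp add: nabla_even_conway_form_single[OF nabla] nabla_even_conway_form_Nil[OF nabla])
  next
    case (snoc a bs)
    then have "cmod (?d bs) < cmod (?d (bs @ [a]))" "b \<noteq> 0"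
      by auto
    then show ?case
      using continuant_step_norm[OF z]
      by (simp add: nabla_even_conway_form_snoc2[OF nabla] poly_of_int_recurrence del: mult_pCons_left)
  qed
  then show ?thesis
    using Nil assms(3) by (cases bs rule: rev_cases) fastforce+
qed

lemma root_region_of_disc:
  fixes w :: complex
  assumes "w \<noteq> 0" "cmod (w - inverse w) < 2"
  shows "(cmod (w\<^sup>2 - 1))\<^sup>2 < 4 * cmod (w\<^sup>2)"
proof -
  have "w\<^sup>2 - 1 = w * (w - inverse w)"
    using assms(1) by (simp add: field_simps power2_eq_square)
  then have "(cmod (w\<^sup>2 - 1))\<^sup>2 = cmod (w\<^sup>2) * (cmod (w - inverse w))\<^sup>2"
    by (simp add: norm_mult norm_power power_mult_distrib)
  also have "\<dots> < cmod (w\<^sup>2) * 4"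
    using power_strict_mono[OF assms(2), of 2] assms(1) by (intro mult_strict_left_mono) auto
  finally show ?thesis by simp
qed

text \<open>The numbers $3 \pm 2 \sqrt 2$ are the zeros of $(r - 1)^2 - 4 r = (r - 3)^2 - 8$.\<close>
lemma quadratic_window:
  fixes r :: real
  assumes "(r - 1)\<^sup>2 < 4 * r"
  shows "3 - 2 * sqrt 2 < r" "r < 3 + 2 * sqrt 2"
proof -
  have "(r - 3)\<^sup>2 < (2 * sqrt 2)\<^sup>2"
    using assms by (simp add: power_mult_distrib) (simp add: power2_eq_square algebra_simps)
  then have "\<bar>r - 3\<bar> < 2 * sqrt 2"
    using abs_le_square_iff[of "2 * sqrt 2" "r - 3"] by auto
  then show "3 - 2 * sqrt 2 < r" "r < 3 + 2 * sqrt 2" by auto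
qed

theorem theorem6p4:
  fixes nabla :: "diagram \<Rightarrow> int poly" and K :: diagram and \<alpha> :: complex
  assumes "conway_polynomial nabla"
    and "two_bridge K"
    and "alexander_root (nabla K) \<alpha>"
  shows "- (3 / 2) < Re \<alpha> \<and> Re \<alpha> < 3 + 2 * sqrt 2 \<and>
    (\<alpha> \<in> \<real> \<longrightarrow> 3 - 2 * sqrt 2 < Re \<alpha> \<and> Re \<alpha> < 3 + 2 * sqrt 2)"
proof -
  obtain bs where bs: "0 \<notin> set bs" "isotopic K (even_conway_form bs)"
    using assms(2) by (auto simp: two_bridge_def)
  then have K: "nabla K = nabla (even_conway_form bs)"
    using assms(1) by (auto simp: conway_polynomial_def)
  obtain w where w: "w\<^sup>2 = \<alpha>" "w \<noteq> 0" "poly (map_poly of_int (nabla K)) (w - inverse w) = 0"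
    using assms(3) by (auto simp: alexander_root_def)
  have "cmod (w - inverse w) < 2"
    using nabla_nonzero_outside_disc[OF assms(1) _ bs(1), of "w - inverse w"] w(3) K by fastforce
  then have bound: "(cmod (\<alpha> - 1))\<^sup>2 < 4 * cmod \<alpha>"
    using root_region_of_disc[OF w(2)] w(1) by simp
  define r where "r = cmod \<alpha>"
  have "(cmod (\<alpha> - 1))\<^sup>2 = r\<^sup>2 - 2 * Re \<alpha> + 1"
    by (simp add: r_def cmod_power2) (simp add: power2_eq_square algebra_simps)
  with bound have key: "r\<^sup>2 - 2 * Re \<alpha> + 1 < 4 * r"
    by (simp add: r_def)
  \<comment> \<open>The minimum of $r^2 - 4 r + 1$ is $-3$, attained at $r = 2$.\<close>
  have "0 \<le> (r - 2)\<^sup>2" by simp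
  then have lower: "- (3 / 2) < Re \<alpha>"
    using key by (simp add: power2_eq_square algebra_simps)
  have "Re \<alpha> \<le> r"
    by (simp add: r_def complex_Re_le_cmod)
  then have r: "(r - 1)\<^sup>2 < 4 * r"
    using key by (simp add: power2_eq_square algebra_simps)
  have upper: "Re \<alpha> < 3 + 2 * sqrt 2"
    using quadratic_window(2)[OF r] \<open>Re \<alpha> \<le> r\<close> by simp
  have "3 - 2 * sqrt 2 < Re \<alpha>" if "\<alpha> \<in> \<real>"
  proof -
    have abs: "r = \<bar>Re \<alpha>\<bar>"
      using that by (auto simp: r_def elim: Reals_cases)
    have "0 \<le> Re \<alpha>"
    proof (rule ccontr)
      assume "\<not> 0 \<le> Re \<alpha>"
      then have "(r - 1)\<^sup>2 < 0"
        using key abs by (simp add: power2_eq_square algebra_simps)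
      then show False by simp
    qed
    then show ?thesis
      using quadratic_window(1)[OF r] abs by simp
  qed
  then show ?thesis
    using lower upper by blast
qed

end
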